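(* Let $f:\mathbb{R}\to\mathbb{R}$ be a continuous function with $f(0)\ge0$. Let $\sigma>0$ be such that $f(\sigma)\le0$, and assume that there exist $M>0$ and $\varepsilon>0$ such that $s\mapsto f(s)+Ms$ is increasing on $(\sigma-\varepsilon,\sigma)$. Then, for every $\lambda\ge0$, there is no positive solution $u\in H_0^1(\Omega)\cap L^\infty(\Omega)$ of $$-\Delta u=\lambda f(u)\ \text{ in }\Omega,\qquad u=0\ \text{ on }\partial\Omega,$$ such that $\|u\|_{L^\infty(\Omega)}=\sigma$.
   Context: $\Omega$ is a smooth open bounded subset of $\mathbb{R}^N$. Solutions are understood in the weak sense. By convention $f(s)=f(0)$ for $s\le0$. *)

theory Defs
  imports "HOL-Probability.Essential_Supremum"
begin

subsection \<open>Smooth functions and smooth open sets\<close>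

text \<open>Functions of class \<open>C\<^sup>k\<close> on the whole space, by recursion through the directional
  derivatives.\<close>

primrec Ck :: "nat \<Rightarrow> ('a::euclidean_space \<Rightarrow> real) \<Rightarrow> bool" where
  "Ck 0 f \<longleftrightarrow> continuous_on UNIV f"
| "Ck (Suc k) f \<longleftrightarrow>
     f differentiable_on UNIV \<and> (\<forall>v. Ck k (\<lambda>x. frechet_derivative f (at x) v))"

definition smooth :: "('a::euclidean_space \<Rightarrow> real) \<Rightarrow> bool" where
  "smooth f \<longleftrightarrow> (\<forall>k. Ck k f)"

text \<open>An open set is smooth if near each boundary point it is, in suitable orthonormal coordinates,
  the strict epigraph of a smooth function of \<open>N - 1\<close> variables. The unit vector \<open>e\<close> is the direction
  of the last coordinate and \<open>x - (x \<bullet> e) *\<^sub>R e\<close> is the projection of \<open>x\<close> onto its orthogonal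
  complement; smooth functions on that hyperplane are exactly the restrictions of smooth functions
  on the whole space. For \<open>N = 1\<close> the graph is a single point.\<close>

definition smooth_open :: "'a::euclidean_space set \<Rightarrow> bool" where
  "smooth_open \<Omega> \<longleftrightarrow> open \<Omega> \<and>
     (\<forall>x0\<in>frontier \<Omega>. \<exists>r>0. \<exists>e \<gamma>. norm e = 1 \<and> smooth \<gamma> \<and>
        \<Omega> \<inter> ball x0 r = {x \<in> ball x0 r. x \<bullet> e > \<gamma> (x - (x \<bullet> e) *\<^sub>R e)})"

subsection \<open>Sobolev and Lebesgue spaces\<close>

text \<open>Functions on \<open>\<Omega>\<close> are represented by functions on the ambient space, whose values outside
  \<open>\<Omega>\<close> are irrelevant, and are considered up to null sets.\<close>

definition test_function :: "'a::euclidean_space set \<Rightarrow> ('a \<Rightarrow> real) \<Rightarrow> bool" where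
  "test_function \<Omega> \<phi> \<longleftrightarrow>
     smooth \<phi> \<and> compact (closure {x. \<phi> x \<noteq> 0}) \<and> closure {x. \<phi> x \<noteq> 0} \<subseteq> \<Omega>"

definition grad :: "('a::euclidean_space \<Rightarrow> real) \<Rightarrow> 'a \<Rightarrow> 'a" where
  "grad \<phi> x = (\<Sum>b\<in>Basis. frechet_derivative \<phi> (at x) b *\<^sub>R b)"

definition locally_integrable ::
    "'a::euclidean_space set \<Rightarrow> ('a \<Rightarrow> 'b::euclidean_space) \<Rightarrow> bool" where
  "locally_integrable \<Omega> u \<longleftrightarrow> (\<forall>K. compact K \<and> K \<subseteq> \<Omega> \<longrightarrow> integrable (lebesgue_on K) u)"

definition has_weak_gradient ::
    "'a::euclidean_space set \<Rightarrow> ('a \<Rightarrow> real) \<Rightarrow> ('a \<Rightarrow> 'a) \<Rightarrow> bool" where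
  "has_weak_gradient \<Omega> u g \<longleftrightarrow> locally_integrable \<Omega> u \<and> locally_integrable \<Omega> g \<and>
     (\<forall>\<phi>. test_function \<Omega> \<phi> \<longrightarrow>
        (LINT x|lebesgue_on \<Omega>. u x *\<^sub>R grad \<phi> x) = - (LINT x|lebesgue_on \<Omega>. \<phi> x *\<^sub>R g x))"

definition L2 :: "'a::euclidean_space set \<Rightarrow> ('a \<Rightarrow> 'b::euclidean_space) set" where
  "L2 \<Omega> = {u \<in> borel_measurable (lebesgue_on \<Omega>). integrable (lebesgue_on \<Omega>) (\<lambda>x. (norm (u x))\<^sup>2)}"

definition Linf_norm :: "'a::euclidean_space set \<Rightarrow> ('a \<Rightarrow> real) \<Rightarrow> ereal" where
  "Linf_norm \<Omega> u = esssup (lebesgue_on \<Omega>) (\<lambda>x. ereal \<bar>u x\<bar>)"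

definition Linf :: "'a::euclidean_space set \<Rightarrow> ('a \<Rightarrow> real) set" where
  "Linf \<Omega> = {u \<in> borel_measurable (lebesgue_on \<Omega>). Linf_norm \<Omega> u < \<infinity>}"

text \<open>Weak gradients are unique only up to null sets, so the Sobolev spaces and norms carry the
  gradient \<open>g\<close> of \<open>u\<close> as an explicit argument.\<close>

definition has_H1_gradient ::
    "'a::euclidean_space set \<Rightarrow> ('a \<Rightarrow> real) \<Rightarrow> ('a \<Rightarrow> 'a) \<Rightarrow> bool" where
  "has_H1_gradient \<Omega> u g \<longleftrightarrow> u \<in> L2 \<Omega> \<and> g \<in> L2 \<Omega> \<and> has_weak_gradient \<Omega> u g"

definition H1_norm :: "'a::euclidean_space set \<Rightarrow> ('a \<Rightarrow> real) \<Rightarrow> ('a \<Rightarrow> 'a) \<Rightarrow> real" where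
  "H1_norm \<Omega> u g =
     sqrt ((LINT x|lebesgue_on \<Omega>. (u x)\<^sup>2) + (LINT x|lebesgue_on \<Omega>. (norm (g x))\<^sup>2))"

text \<open>\<open>H\<^sub>0\<^sup>1(\<Omega>)\<close> is the closure of the test functions in \<open>H\<^sup>1(\<Omega>)\<close>.\<close>

definition has_H10_gradient ::
    "'a::euclidean_space set \<Rightarrow> ('a \<Rightarrow> real) \<Rightarrow> ('a \<Rightarrow> 'a) \<Rightarrow> bool" where
  "has_H10_gradient \<Omega> u g \<longleftrightarrow> has_H1_gradient \<Omega> u g \<and>
     (\<exists>\<phi>. (\<forall>k. test_function \<Omega> (\<phi> k)) \<and>
        (\<lambda>k. H1_norm \<Omega> (\<lambda>x. u x - \<phi> k x) (\<lambda>x. g x - grad (\<phi> k) x)) \<longlonglongrightarrow> 0)"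

definition H10 :: "'a::euclidean_space set \<Rightarrow> ('a \<Rightarrow> real) set" where
  "H10 \<Omega> = {u. \<exists>g. has_H10_gradient \<Omega> u g}"

subsection \<open>Weak solutions\<close>

text \<open>Weak solutions of \<open>-\<Delta>u = F(u)\<close> in \<open>\<Omega>\<close>, \<open>u = 0\<close> on \<open>\<partial>\<Omega>\<close>; the boundary condition is
  membership in \<open>H\<^sub>0\<^sup>1(\<Omega>)\<close>. The integrability clause excludes the default value of a divergent
  integral; it is automatic for bounded \<open>u\<close> and \<open>\<Omega>\<close> and continuous \<open>F\<close>.\<close>

definition weak_solution ::
    "'a::euclidean_space set \<Rightarrow> (real \<Rightarrow> real) \<Rightarrow> ('a \<Rightarrow> real) \<Rightarrow> bool" where
  "weak_solution \<Omega> F u \<longleftrightarrow>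
     (\<exists>g. has_H10_gradient \<Omega> u g \<and>
       (\<forall>v h. has_H10_gradient \<Omega> v h \<longrightarrow>
          integrable (lebesgue_on \<Omega>) (\<lambda>x. F (u x) * v x) \<and>
          (LINT x|lebesgue_on \<Omega>. g x \<bullet> h x) = (LINT x|lebesgue_on \<Omega>. F (u x) * v x)))"

definition positive_on :: "'a::euclidean_space set \<Rightarrow> ('a \<Rightarrow> real) \<Rightarrow> bool" where
  "positive_on \<Omega> u \<longleftrightarrow> (AE x in lebesgue_on \<Omega>. 0 < u x)"

end

theory Submission
  imports Defs
begin

text \<open>Put \<open>w = \<sigma> - u \<ge> 0\<close>. Near \<open>\<sigma>\<close> the monotonicity of \<open>f s + M * s\<close>, together with \<open>f \<sigma> \<le> 0\<close>,
  gives \<open>f s \<le> M * (\<sigma> - s)\<close>; away from \<open>\<sigma>\<close> the factor \<open>\<sigma> - s\<close> is bounded below and \<open>f\<close> is bounded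
  above. Hence \<open>l * f u \<le> C * w\<close> for some \<open>C > 0\<close> (\<open>one_sided_linear_bound\<close>), so that \<open>w\<close> is a weak
  supersolution of \<open>- \<Delta> w + C * w = 0\<close> with boundary value \<open>\<sigma>\<close>. Because \<open>C > 0\<close>, this operator
  satisfies a comparison principle on the whole of \<open>\<Omega>\<close>, up to the boundary. It therefore suffices to
  compare \<open>w\<close> with one explicit subsolution \<open>\<psi> \<le> \<sigma>\<close> that is bounded below on \<open>\<Omega>\<close> by a constant
  \<open>\<delta> > 0\<close> (\<open>positive_subsolution\<close>): then \<open>u \<le> \<sigma> - \<delta>\<close> almost everywhere, and the essential supremum
  of \<open>\<bar>u\<bar>\<close> cannot be \<open>\<sigma>\<close>.

  The comparison (\<open>weak_comparison\<close>) would classically be tested with the positive part of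
  \<open>s = u + \<psi> - \<sigma>\<close>, which requires a chain rule in \<open>H\<^sub>0\<^sup>1(\<Omega>)\<close>. Here it is tested with
  \<open>G (\<phi>\<^sub>k + \<psi> - \<sigma>)\<close>, where \<open>\<phi>\<^sub>k\<close> are test functions converging to \<open>u\<close> and \<open>G t = exp (- 1 / t)\<close> for
  \<open>t > 0\<close>, \<open>G t = 0\<close> for \<open>t \<le> 0\<close> (the function \<open>flat\<close>). As \<open>\<psi> \<le> \<sigma>\<close>, this vanishes wherever \<open>\<phi>\<^sub>k\<close> does, so it is itself a
  test function and its gradient is given by the classical chain rule. Two pointwise inequalities,
  \<open>flat_perturb\<close> and \<open>inner_square_completion\<close>, bound the errors by the squared \<open>H\<^sup>1\<close> distance
  between \<open>\<phi>\<^sub>k\<close> and \<open>u\<close>. In the limit the integral of \<open>s * G (s / 2) \<ge> 0\<close> is at most zero, which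
  forces \<open>s \<le> 0\<close> almost everywhere.\<close>

section \<open>Calculus of smooth functions\<close>

lemma Ck_SucI:
  assumes "\<And>x. (f has_derivative D x) (at x)" and "\<And>v. Ck k (\<lambda>x. D x v)"
  shows "Ck (Suc k) f"
proof -
  have "frechet_derivative f (at x) = D x" for x
    using frechet_derivative_at[OF assms(1)] by simp
  moreover have "f differentiable_on UNIV"
    using assms(1) by (auto simp: differentiable_on_def differentiable_def)
  ultimately show ?thesis
    using assms(2) by simp
qed

lemma Ck_SucD:
  assumes "Ck (Suc k) f"
  shows "(f has_derivative frechet_derivative f (at x)) (at x)"
    and "Ck k (\<lambda>x. frechet_derivative f (at x) v)"
  using assms by (auto simp: differentiable_on_def frechet_derivative_works)

lemma Ck_decrease: "Ck (Suc k) f \<Longrightarrow> Ck k f"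
proof (induction k arbitrary: f)
  case 0
  then show ?case
    by (auto intro: differentiable_imp_continuous_on)
next
  case (Suc k)
  then have "Ck (Suc k) (\<lambda>x. frechet_derivative f (at x) v)" for v
    using Ck_SucD(2) by blast
  then show ?case
    using Suc.IH Ck_SucI[OF Ck_SucD(1)[OF Suc.prems]] by blast
qed

lemma Ck_const: "Ck k (\<lambda>x. c)"
proof (induction k arbitrary: c)
  case (Suc k)
  show ?case
    by (rule Ck_SucI[where D = "\<lambda>x v. 0"]) (auto intro: Suc)
qed simp

lemma Ck_add: "Ck k f \<Longrightarrow> Ck k g \<Longrightarrow> Ck k (\<lambda>x. f x + g x)"
proof (induction k arbitrary: f g)
  case 0
  then show ?case by (simp add: continuous_on_add)
next
  case (Suc k)
  show ?case
    by (rule Ck_SucI[OF has_derivative_add[OF Ck_SucD(1)[OF Suc.prems(1)] Ck_SucD(1)[OF Suc.prems(2)]]])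
       (rule Suc.IH[OF Ck_SucD(2)[OF Suc.prems(1)] Ck_SucD(2)[OF Suc.prems(2)]])
qed

lemma Ck_mult: "Ck k f \<Longrightarrow> Ck k g \<Longrightarrow> Ck k (\<lambda>x. f x * g x)"
proof (induction k arbitrary: f g)
  case 0
  then show ?case by (simp add: continuous_on_mult)
next
  case (Suc k)
  show ?case
    by (rule Ck_SucI[OF has_derivative_mult[OF Ck_SucD(1)[OF Suc.prems(1)] Ck_SucD(1)[OF Suc.prems(2)]]])
       (rule Ck_add[OF Suc.IH[OF Ck_decrease[OF Suc.prems(1)] Ck_SucD(2)[OF Suc.prems(2)]]
           Suc.IH[OF Ck_SucD(2)[OF Suc.prems(1)] Ck_decrease[OF Suc.prems(2)]]])
qed

text \<open>The one-variable functions range over a class closed under differentiation, so that the induction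
  on \<open>k\<close> can pass from \<open>G\<close> to \<open>G'\<close> without a notion of higher derivative.\<close>

lemma Ck_compose:
  assumes closed: "\<And>G. G \<in> \<G> \<Longrightarrow> \<exists>G'\<in>\<G>. \<forall>s. (G has_real_derivative G' s) (at s)"
    and "G \<in> \<G>" and "Ck k p"
  shows "Ck k (\<lambda>x. G (p x))"
  using assms(2,3)
proof (induction k arbitrary: G)
  case 0
  obtain G' where "\<And>s. (G has_real_derivative G' s) (at s)"
    using closed[OF \<open>G \<in> \<G>\<close>] by blast
  then have "continuous_on UNIV G"
    by (meson DERIV_isCont continuous_at_imp_continuous_on)
  then show ?case
    using 0 continuous_on_compose2[of UNIV G UNIV p] by simp
next
  case (Suc k)
  obtain G' where G': "G' \<in> \<G>" "\<And>s. (G has_real_derivative G' s) (at s)"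
    using closed[OF \<open>G \<in> \<G>\<close>] by blast
  show ?case
  proof (rule Ck_SucI)
    show "((\<lambda>x. G (p x)) has_derivative (\<lambda>v. frechet_derivative p (at x) v * G' (p x))) (at x)" for x
      using DERIV_compose_FDERIV[OF G'(2) Ck_SucD(1)[OF Suc.prems(2)]] .
    show "Ck k (\<lambda>x. frechet_derivative p (at x) v * G' (p x))" for v
      by (rule Ck_mult[OF Ck_SucD(2)[OF Suc.prems(2)] Suc.IH[OF G'(1) Ck_decrease[OF Suc.prems(2)]]])
  qed
qed

lemma Ck_inner: "Ck k (\<lambda>x. x \<bullet> b)"
proof (cases k)
  case (Suc m)
  show ?thesis
    unfolding Suc
    by (rule Ck_SucI[where D = "\<lambda>x v. v \<bullet> b"]) (auto intro!: derivative_eq_intros Ck_const)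
qed (auto intro: continuous_intros)

lemma smooth_const: "smooth (\<lambda>x. c)"
  and smooth_inner: "smooth (\<lambda>x. x \<bullet> b)"
  and smooth_add: "smooth f \<Longrightarrow> smooth g \<Longrightarrow> smooth (\<lambda>x. f x + g x)"
  and smooth_mult: "smooth f \<Longrightarrow> smooth g \<Longrightarrow> smooth (\<lambda>x. f x * g x)"
  by (simp_all add: smooth_def Ck_const Ck_inner Ck_add Ck_mult)

lemma smooth_continuous_on: "smooth f \<Longrightarrow> continuous_on A f"
  unfolding smooth_def by (metis Ck.simps(1) continuous_on_subset subset_UNIV)

lemma smooth_has_derivative:
  "smooth f \<Longrightarrow> (f has_derivative frechet_derivative f (at x)) (at x)"
  unfolding smooth_def using Ck_SucD(1) by blast

lemma smooth_directional_derivative: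
  "smooth f \<Longrightarrow> smooth (\<lambda>x. frechet_derivative f (at x) v)"
  unfolding smooth_def using Ck_SucD(2) by blast

lemma grad_inner:
  assumes "smooth \<phi>"
  shows "grad \<phi> x \<bullet> v = frechet_derivative \<phi> (at x) v"
proof -
  let ?D = "frechet_derivative \<phi> (at x)"
  have lin: "linear ?D"
    using smooth_has_derivative[OF assms] has_derivative_linear by blast
  have "?D v = ?D (\<Sum>b\<in>Basis. (v \<bullet> b) *\<^sub>R b)"
    by (simp add: euclidean_representation)
  also have "\<dots> = (\<Sum>b\<in>Basis. (v \<bullet> b) * ?D b)"
    by (simp add: linear_sum[OF lin] linear_scale[OF lin])
  finally show ?thesis
    by (simp add: grad_def inner_sum_left inner_commute[of v] mult.commute)
qed

lemma smooth_has_derivative_grad: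
  "smooth \<phi> \<Longrightarrow> (\<phi> has_derivative (\<lambda>v. grad \<phi> x \<bullet> v)) (at x)"
  using smooth_has_derivative[of \<phi> x] grad_inner[of \<phi> x] by simp

lemma grad_eqI:
  assumes "(\<phi> has_derivative (\<lambda>v. w \<bullet> v)) (at x)"
  shows "grad \<phi> x = w"
proof -
  have "frechet_derivative \<phi> (at x) = (\<lambda>v. w \<bullet> v)"
    using frechet_derivative_at[OF assms] by simp
  then show ?thesis
    by (simp add: grad_def euclidean_representation)
qed

lemma smooth_grad_inner: "smooth \<phi> \<Longrightarrow> smooth (\<lambda>x. grad \<phi> x \<bullet> v)"
  by (simp add: grad_inner smooth_directional_derivative)

lemma continuous_on_grad: "smooth \<phi> \<Longrightarrow> continuous_on A (grad \<phi>)"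
  unfolding grad_def
  by (intro continuous_intros smooth_continuous_on smooth_directional_derivative)

lemma smooth_compose:
  assumes "\<And>G. G \<in> \<G> \<Longrightarrow> \<exists>G'\<in>\<G>. \<forall>s. (G has_real_derivative G' s) (at s)"
    and "G \<in> \<G>" and "smooth p"
  shows "smooth (\<lambda>x. G (p x))"
  using Ck_compose[of \<G> G] assms unfolding smooth_def by blast

lemma smooth_exp:
  assumes "smooth p"
  shows "smooth (\<lambda>x. exp (p x) :: real)"
  using smooth_compose[where \<G> = "{exp}" and G = exp] assms DERIV_exp by blast

section \<open>The flat exponential\<close>

text \<open>The polynomial factor in \<open>1 / s\<close> makes the family closed under differentiation; the function
  \<open>exp (- 1 / s)\<close> itself is the case \<open>P = 1\<close>.\<close>

definition flat_exp :: "real poly \<Rightarrow> real \<Rightarrow> real" where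
  "flat_exp P s = (if s > 0 then poly P (1 / s) * exp (- (1 / s)) else 0)"

lemma poly_exp_decay: "((\<lambda>y. poly P y * exp (- y :: real)) \<longlongrightarrow> 0) at_top"
proof -
  have "((\<lambda>y. \<Sum>i\<le>degree P. coeff P i * (y ^ i / exp y)) \<longlongrightarrow> (\<Sum>i\<le>degree P. coeff P i * 0)) at_top"
    by (intro tendsto_intros tendsto_power_div_exp_0)
  then show ?thesis
    by (simp add: poly_altdef exp_minus divide_inverse sum_distrib_right mult.assoc)
qed

lemma flat_exp_has_derivative:
  "(flat_exp P has_real_derivative flat_exp ([:0, 0, 1:] * (P - pderiv P)) s) (at s)"
proof (cases s "0::real" rule: linorder_cases)
  case less
  have "(flat_exp P has_real_derivative 0) (at s)"
    by (rule has_field_derivative_transform_within_open[of "\<lambda>s. 0" _ _ "{..<0}"])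
       (use less in \<open>auto simp: flat_exp_def\<close>)
  then show ?thesis using less by (simp add: flat_exp_def)
next
  case greater
  have "((\<lambda>s. poly P (1 / s) * exp (- (1 / s))) has_real_derivative
      flat_exp ([:0, 0, 1:] * (P - pderiv P)) s) (at s)"
    using greater
    by (auto simp: flat_exp_def field_simps power2_eq_square
        intro!: derivative_eq_intros DERIV_chain2[OF poly_DERIV])
  then show ?thesis
    by (rule has_field_derivative_transform_within_open[of _ _ _ "{0<..}"])
       (use greater in \<open>auto simp: flat_exp_def\<close>)
next
  case equal
  have right: "((\<lambda>h. flat_exp P h / h) \<longlongrightarrow> 0) (at_right 0)"
  proof -
    have "((\<lambda>h. poly ([:0, 1:] * P) (inverse h) * exp (- inverse h)) \<longlongrightarrow> 0) (at_right 0)"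
      using filterlim_compose[OF poly_exp_decay filterlim_inverse_at_top_right] .
    then show ?thesis
      by (rule Lim_transform_eventually)
         (auto simp: flat_exp_def eventually_at_filter field_simps)
  qed
  have left: "((\<lambda>h. flat_exp P h / h) \<longlongrightarrow> 0) (at_left 0)"
    by (rule Lim_transform_eventually[OF tendsto_const])
       (auto simp: flat_exp_def eventually_at_filter)
  have "((\<lambda>h. flat_exp P h / h) \<longlongrightarrow> 0) (at 0)"
    using left right by (simp add: filterlim_split_at)
  then show ?thesis
    using equal by (simp add: DERIV_def flat_exp_def)
qed

abbreviation flat :: "real \<Rightarrow> real" where
  "flat \<equiv> flat_exp 1"

abbreviation flat_slope :: "real \<Rightarrow> real" where
  "flat_slope \<equiv> flat_exp [:0, 0, 1:]"

lemma smooth_flat_exp: "smooth p \<Longrightarrow> smooth (\<lambda>x. flat_exp P (p x))"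
  by (rule smooth_compose[where \<G> = "range flat_exp"]) (use flat_exp_has_derivative in blast)+

lemma flat_has_derivative:
  "(flat has_real_derivative flat_slope s) (at s)"
  using flat_exp_has_derivative[of 1 s] by (simp add: pderiv_1)

lemma flat_slope_bounds: "0 \<le> flat_slope s" "flat_slope s \<le> 2"
proof -
  show "0 \<le> flat_slope s" by (simp add: flat_exp_def)
  show "flat_slope s \<le> 2"
  proof (cases "s > 0")
    case True
    then have "1 + 1 / s + (1 / s)\<^sup>2 / 2 \<le> exp (1 / s)"
      by (intro exp_lower_Taylor_quadratic) simp
    moreover have "1 / s > 0" using True by simp
    ultimately have "(1 / s)\<^sup>2 \<le> 2 * exp (1 / s)" by linarith
    then show ?thesis
      using True by (simp add: flat_exp_def exp_minus divide_simps power2_eq_square mult_ac)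
  qed (simp add: flat_exp_def)
qed

lemma flat_mono: "s \<le> t \<Longrightarrow> flat s \<le> flat t"
  by (rule DERIV_nonneg_imp_nondecreasing) (use flat_has_derivative flat_slope_bounds in blast)+

lemma flat_bounds:
  "0 \<le> flat s" "flat s \<le> \<bar>s\<bar>" "flat s \<le> 1" 
  "s \<le> 0 \<Longrightarrow> flat s = 0" "0 < s \<Longrightarrow> 0 < flat s"
proof -
  show "flat s \<le> \<bar>s\<bar>"
  proof (cases "s > 0")
    case True
    have "1 / s \<le> exp (1 / s)"
      using exp_ge_add_one_self[of "1 / s"] by linarith
    then show ?thesis
      using True by (simp add: flat_exp_def exp_minus field_simps)
  qed (simp add: flat_exp_def)
qed (auto simp: flat_exp_def)

text \<open>This replaces \<open>s = u + \<psi> - \<sigma>\<close> by its approximation \<open>s + e = \<phi>\<^sub>k + \<psi> - \<sigma>\<close> at a cost that is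
  quadratic in the error \<open>e\<close>. If \<open>s > 0\<close>, halving the argument on the left leaves room for an error
  \<open>e \<ge> - s / 2\<close> by monotonicity, and a larger negative error has \<open>\<bar>e\<bar> > s / 2\<close>, so that \<open>flat t \<le> \<bar>t\<bar>\<close> suffices.
  If \<open>s \<le> 0\<close>, then \<open>flat (s + e)\<close> is nonzero only when \<open>e\<close> exceeds \<open>\<bar>s\<bar>\<close>.\<close>

lemma flat_perturb:
  "s * flat (s / 2) \<le> s * flat (s + e) + 4 * e\<^sup>2"
proof -
  consider "s \<le> 0" "s + e \<le> 0" | "s \<le> 0" "s + e > 0" | "s > 0" "e \<ge> - s / 2" | "s > 0" "e < - s / 2"
    by linarith
  then show ?thesis
  proof cases
    case 1
    then show ?thesis by (simp add: flat_bounds(4))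
  next
    case 2
    have "- s * flat (s + e) \<le> e * e"
      using flat_bounds(1,2)[of "s + e"] 2 by (intro mult_mono) auto
    moreover have "0 \<le> e * e" by simp
    ultimately have "0 \<le> s * flat (s + e) + 4 * (e * e)" by linarith
    then show ?thesis using 2 by (simp add: flat_bounds(4) power2_eq_square)
  next
    case 3
    then have "s * flat (s / 2) \<le> s * flat (s + e)"
      by (intro mult_left_mono flat_mono) auto
    then show ?thesis by (simp add: add_increasing2)
  next
    case 4
    have "s * flat (s / 2) \<le> (- 2 * e) * (- e)"
      using flat_bounds(1,2)[of "s / 2"] 4 by (intro mult_mono) auto
    also have "\<dots> \<le> 4 * e\<^sup>2" by (simp add: power2_eq_square)
    finally show ?thesis using 4 flat_bounds(1)[of "s + e"] by (simp add: add_increasing)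
  qed
qed

section \<open>Test functions and integration by parts\<close>

lemma integral_lborel_shift:
  fixes F :: "'a::euclidean_space \<Rightarrow> real"
  assumes "F \<in> borel_measurable borel"
  shows "(\<integral>x. F (x + c) \<partial>lborel) = (\<integral>x. F x \<partial>lborel)"
    and "integrable lborel F \<Longrightarrow> integrable lborel (\<lambda>x. F (x + c))"
proof -
  have "(\<integral>x. F x \<partial>distr lborel borel ((+) c)) = (\<integral>x. F (c + x) \<partial>lborel)"
    using assms by (intro integral_distr) auto
  then show "(\<integral>x. F (x + c) \<partial>lborel) = (\<integral>x. F x \<partial>lborel)"
    by (simp add: lborel_distr_plus add.commute)
  assume "integrable lborel F"
  then have "integrable (distr lborel borel ((+) c)) F"
    by (simp add: lborel_distr_plus)
  then show "integrable lborel (\<lambda>x. F (x + c))"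
    using assms by (subst (asm) integrable_distr_eq) (auto simp: add.commute)
qed

lemma integrable_compact_support:
  fixes f :: "'a::euclidean_space \<Rightarrow> 'b::euclidean_space"
  assumes cont: "continuous_on UNIV f" and K: "compact K" "\<And>x. x \<notin> K \<Longrightarrow> f x = 0"
  shows "integrable lborel f"
    and "\<lbrakk>open \<Omega>; K \<subseteq> \<Omega>\<rbrakk> \<Longrightarrow> integrable (lebesgue_on \<Omega>) f"
    and "\<lbrakk>open \<Omega>; K \<subseteq> \<Omega>\<rbrakk> \<Longrightarrow> integral\<^sup>L (lebesgue_on \<Omega>) f = integral\<^sup>L lborel f"
proof -
  have "(\<lambda>x. indicator K x *\<^sub>R f x) = f"
    using K(2) by (auto simp: indicator_def fun_eq_iff)
  then show int: "integrable lborel f"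
    using borel_integrable_compact[OF K(1) continuous_on_subset[OF cont]] by simp
  have meas: "f \<in> borel_measurable lborel"
    using cont by (simp add: borel_measurable_continuous_onI)
  assume \<Omega>: "open \<Omega>" "K \<subseteq> \<Omega>"
  then have ind: "(\<lambda>x. indicator \<Omega> x *\<^sub>R f x) = f"
    using K(2) by (auto simp: indicator_def fun_eq_iff)
  show "integrable (lebesgue_on \<Omega>) f"
    using \<Omega>(1) int meas by (subst integrable_restrict_space) (auto simp: ind integrable_completion)
  show "integral\<^sup>L (lebesgue_on \<Omega>) f = integral\<^sup>L lborel f"
    using \<Omega>(1) meas by (subst integral_restrict_space) (auto simp: ind integral_completion)
qed

lemma grad_eq_0_outside_support:
  assumes "closed K" "\<And>x. x \<notin> K \<Longrightarrow> F x = 0" "x \<notin> K"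
  shows "grad F x = 0"
proof (rule grad_eqI)
  have "((\<lambda>x. 0) has_derivative (\<lambda>v. 0)) (at x)" by simp
  then have "(F has_derivative (\<lambda>v. 0)) (at x)"
    by (rule has_derivative_transform_within_open[of _ _ _ _ "- K"]) (use assms in auto)
  then show "(F has_derivative (\<lambda>v. 0 \<bullet> v)) (at x)" by simp
qed

text \<open>By translation invariance every difference quotient of \<open>F\<close> has integral zero. For increments of
  length at most that of \<open>b\<close> the quotients are bounded by the maximum of \<open>\<bar>grad F \<bullet> b\<bar>\<close> and supported
  in a fixed compact enlargement of \<open>K\<close>, so dominated convergence applies.\<close>

lemma integral_grad_eq_0:
  fixes F :: "'a::euclidean_space \<Rightarrow> real"
  assumes F: "smooth F" and K: "compact K" "\<And>x. x \<notin> K \<Longrightarrow> F x = 0"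
  shows "(\<integral>x. grad F x \<bullet> b \<partial>lborel) = 0"
proof -
  define D where "D x = grad F x \<bullet> b" for x
  define h where "h n = inverse (real (Suc n))" for n
  define Q where "Q n x = (F (x + h n *\<^sub>R b) - F x) / h n" for n x
  have h: "h n > 0" "h n \<le> 1" for n
    by (auto simp: h_def field_simps)
  have D_cont: "continuous_on UNIV D"
    unfolding D_def by (intro smooth_continuous_on smooth_grad_inner F)
  have D_0: "D x = 0" if "x \<notin> K" for x
    using grad_eq_0_outside_support[OF compact_imp_closed[OF K(1)] K(2) that] by (simp add: D_def)
  have "bounded (D ` K)"
    using K(1) D_cont by (intro compact_imp_bounded compact_continuous_image) (auto intro: continuous_on_subset)
  then obtain B where B: "\<And>x. x \<in> K \<Longrightarrow> \<bar>D x\<bar> \<le> B" "B > 0"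
    unfolding bounded_pos by auto
  have D_bound: "\<bar>D x\<bar> \<le> B" for x
    using B D_0 by (cases "x \<in> K") auto
  have F_line: "((\<lambda>t. F (x + t *\<^sub>R b)) has_real_derivative D (x + t *\<^sub>R b)) (at t)" for x t
  proof -
    have "((\<lambda>t. x + t *\<^sub>R b) has_derivative (\<lambda>t. t *\<^sub>R b)) (at t)"
      by (auto intro!: derivative_eq_intros)
    then have "((\<lambda>t. F (x + t *\<^sub>R b)) has_derivative (\<lambda>s. grad F (x + t *\<^sub>R b) \<bullet> (s *\<^sub>R b))) (at t)"
      by (rule has_derivative_compose) (rule smooth_has_derivative_grad[OF F])
    then show ?thesis
      by (rule has_derivative_imp_has_field_derivative) (simp add: D_def)
  qed
  have F_meas: "F \<in> borel_measurable borel"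
    using F by (intro borel_measurable_continuous_onI smooth_continuous_on)
  have F_int: "integrable lborel F"
    using integrable_compact_support(1)[OF smooth_continuous_on[OF F] K] .
  \<comment> \<open>Contains the supports of all difference quotients, as the increments are at most \<open>norm b\<close> long.\<close>
  define K' where "K' = (\<Union>x\<in>K. \<Union>y\<in>cball 0 (norm b). {x + y})"
  have K': "compact K'"
    unfolding K'_def by (rule compact_sums'[OF K(1) compact_cball])
  have Q_bound: "\<bar>Q n x\<bar> \<le> B * indicator K' x" for n x
  proof (cases "x \<in> K'")
    case True
    from MVT2[of 0 "h n" "\<lambda>t. F (x + t *\<^sub>R b)" "\<lambda>t. D (x + t *\<^sub>R b)"] h(1)[of n] F_line[of x]
    obtain t where "F (x + h n *\<^sub>R b) - F (x + 0 *\<^sub>R b) = (h n - 0) * D (x + t *\<^sub>R b)"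
      by blast
    then have "Q n x = D (x + t *\<^sub>R b)"
      using h(1)[of n] by (simp add: Q_def)
    then show ?thesis using True D_bound by simp
  next
    case False
    have "x \<notin> K"
      using False by (force simp: K'_def)
    moreover have "x + h n *\<^sub>R b \<notin> K"
    proof
      assume "x + h n *\<^sub>R b \<in> K"
      moreover have "- (h n *\<^sub>R b) \<in> cball 0 (norm b)"
        using h[of n] by (simp add: mult_left_le_one_le)
      moreover have "x = (x + h n *\<^sub>R b) + - (h n *\<^sub>R b)" by simp
      ultimately have "x \<in> K'" unfolding K'_def by (intro UN_I[of "x + h n *\<^sub>R b"] UN_I[of "- (h n *\<^sub>R b)"]) simp_all
      then show False using False by simp
    qed
    ultimately show ?thesis using False by (simp add: Q_def K(2))
  qed
  have "(\<lambda>n. \<integral>x. Q n x \<partial>lborel) \<longlonglongrightarrow> (\<integral>x. D x \<partial>lborel)"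
  proof (rule integral_dominated_convergence)
    show "D \<in> borel_measurable lborel"
      using D_cont by (simp add: borel_measurable_continuous_onI)
    show "Q n \<in> borel_measurable lborel" for n
      unfolding Q_def using F_meas by measurable
    show "integrable lborel (\<lambda>x. B * indicator K' x)"
      using borel_integrable_compact[OF K', of "\<lambda>x. 1::real"] by simp
    show "AE x in lborel. norm (Q n x) \<le> B * indicator K' x" for n
      using Q_bound by simp
    have "(\<lambda>n. Q n x) \<longlonglongrightarrow> D x" for x
    proof -
      have "((\<lambda>s. (F (x + s *\<^sub>R b) - F x) / s) \<longlongrightarrow> D x) (at 0)"
        using F_line[of x 0] by (simp add: DERIV_def)
      moreover have "h \<longlonglongrightarrow> 0"
        unfolding h_def by (rule LIMSEQ_inverse_real_of_nat)
      then have "filterlim h (at 0) sequentially"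
        using h(1) by (simp add: filterlim_at less_imp_neq[symmetric])
      ultimately show ?thesis
        unfolding Q_def by (rule filterlim_compose)
    qed
    then show "AE x in lborel. (\<lambda>n. Q n x) \<longlonglongrightarrow> D x" by simp
  qed
  moreover have "(\<integral>x. Q n x \<partial>lborel) = 0" for n
    unfolding Q_def using integral_lborel_shift[OF F_meas, of "h n *\<^sub>R b"] F_int by simp
  ultimately have "(\<integral>x. D x \<partial>lborel) = 0"
    by (simp add: LIMSEQ_const_iff)
  then show ?thesis by (simp add: D_def)
qed

lemma test_functionD:
  assumes "test_function \<Omega> \<phi>"
  obtains K where "compact K" "K \<subseteq> \<Omega>" "\<And>x. x \<notin> K \<Longrightarrow> \<phi> x = 0" "\<And>x. x \<notin> K \<Longrightarrow> grad \<phi> x = 0"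
proof
  let ?K = "closure {x. \<phi> x \<noteq> 0}"
  show "compact ?K" "?K \<subseteq> \<Omega>"
    using assms by (simp_all add: test_function_def)
  show zero: "\<phi> x = 0" if "x \<notin> ?K" for x
    using that closure_subset[of "{x. \<phi> x \<noteq> 0}"] by auto
  show "grad \<phi> x = 0" if "x \<notin> ?K" for x
    using grad_eq_0_outside_support[OF closed_closure zero that] .
qed

lemma test_function_smooth: "test_function \<Omega> \<phi> \<Longrightarrow> smooth \<phi>"
  by (simp add: test_function_def)

lemma grad_mult:
  assumes "smooth f" "smooth g"
  shows "grad (\<lambda>x. f x * g x) x = f x *\<^sub>R grad g x + g x *\<^sub>R grad f x"
proof (rule grad_eqI)
  have "((\<lambda>x. f x * g x) has_derivative
      (\<lambda>v. f x * (grad g x \<bullet> v) + (grad f x \<bullet> v) * g x)) (at x)"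
    by (intro has_derivative_mult smooth_has_derivative_grad assms)
  then show "((\<lambda>x. f x * g x) has_derivative
      (\<lambda>v. (f x *\<^sub>R grad g x + g x *\<^sub>R grad f x) \<bullet> v)) (at x)"
    by (simp add: inner_add_left mult.commute)
qed

lemma integrable_test_function:
  assumes "open \<Omega>" "test_function \<Omega> \<theta>" "continuous_on UNIV p"
  shows "integrable (lebesgue_on \<Omega>) (\<lambda>x. p x * \<theta> x)"
proof -
  obtain K where K: "compact K" "K \<subseteq> \<Omega>" "\<And>x. x \<notin> K \<Longrightarrow> \<theta> x = 0" "\<And>x. x \<notin> K \<Longrightarrow> grad \<theta> x = 0"
    using test_functionD[OF assms(2)] by blast
  have "continuous_on UNIV \<theta>"
    using smooth_continuous_on[OF test_function_smooth[OF assms(2)]] .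
  then show ?thesis
    using K(3) by (intro integrable_compact_support(2)[OF continuous_on_mult[OF assms(3)] K(1) _ assms(1) K(2)]) simp_all
qed

lemma integrable_grad_test_function:
  assumes "open \<Omega>" "test_function \<Omega> \<theta>" "continuous_on UNIV P"
  shows "integrable (lebesgue_on \<Omega>) (\<lambda>x. P x \<bullet> grad \<theta> x)"
proof -
  obtain K where K: "compact K" "K \<subseteq> \<Omega>" "\<And>x. x \<notin> K \<Longrightarrow> \<theta> x = 0" "\<And>x. x \<notin> K \<Longrightarrow> grad \<theta> x = 0"
    using test_functionD[OF assms(2)] by blast
  have "continuous_on UNIV (grad \<theta>)"
    using continuous_on_grad[OF test_function_smooth[OF assms(2)]] .
  then show ?thesis
    using K(4) by (intro integrable_compact_support(2)[OF continuous_on_inner[OF assms(3)] K(1) _ assms(1) K(2)]) simp_all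
qed

lemma integration_by_parts:
  assumes "open \<Omega>" "test_function \<Omega> \<theta>" "smooth p"
  shows "(LINT x|lebesgue_on \<Omega>. p x * (grad \<theta> x \<bullet> b)) = - (LINT x|lebesgue_on \<Omega>. (grad p x \<bullet> b) * \<theta> x)"
proof -
  obtain K where K: "compact K" "K \<subseteq> \<Omega>" "\<And>x. x \<notin> K \<Longrightarrow> \<theta> x = 0" "\<And>x. x \<notin> K \<Longrightarrow> grad \<theta> x = 0"
    using test_functionD[OF assms(2)] by blast
  note smooth = test_function_smooth[OF assms(2)]
  have "integrable (lebesgue_on \<Omega>) (\<lambda>x. (p x *\<^sub>R b) \<bullet> grad \<theta> x)"
    using smooth_continuous_on[OF assms(3)]
    by (intro integrable_grad_test_function assms(1,2) continuous_on_scaleR continuous_on_const)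
  then have int1: "integrable (lebesgue_on \<Omega>) (\<lambda>x. p x * (grad \<theta> x \<bullet> b))"
    by (simp add: inner_commute)
  have int2: "integrable (lebesgue_on \<Omega>) (\<lambda>x. (grad p x \<bullet> b) * \<theta> x)"
    by (intro integrable_test_function assms(1,2) smooth_continuous_on smooth_grad_inner assms(3))
  have "(\<lambda>x. grad (\<lambda>x. p x * \<theta> x) x \<bullet> b) =
      (\<lambda>x. p x * (grad \<theta> x \<bullet> b) + (grad p x \<bullet> b) * \<theta> x)"
    using grad_mult[OF assms(3) smooth] by (simp add: inner_add_left mult.commute)
  moreover have "(LINT x|lebesgue_on \<Omega>. grad (\<lambda>x. p x * \<theta> x) x \<bullet> b) =
      (LINT x|lborel. grad (\<lambda>x. p x * \<theta> x) x \<bullet> b)"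
    using assms K smooth
    by (intro integrable_compact_support(3)[OF _ K(1)] smooth_continuous_on smooth_grad_inner smooth_mult)
       (auto simp: grad_mult)
  moreover have "\<dots> = 0"
    using K assms(3) smooth by (intro integral_grad_eq_0[OF _ K(1)] smooth_mult) auto
  ultimately show ?thesis
    using int1 int2 by simp
qed

lemma locally_integrable_continuous:
  fixes f :: "'a::euclidean_space \<Rightarrow> 'b::euclidean_space"
  assumes "continuous_on UNIV f"
  shows "locally_integrable \<Omega> f"
  unfolding locally_integrable_def
proof (intro allI impI)
  fix K :: "'a set"
  assume "compact K \<and> K \<subseteq> \<Omega>"
  then have K: "compact K" by simp
  then have "integrable lborel (\<lambda>x. indicator K x *\<^sub>R f x)"
    using borel_integrable_compact continuous_on_subset[OF assms] by blast
  moreover have "K \<in> sets borel" using K by (rule borel_compact)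
  moreover have "f \<in> borel_measurable borel"
    using assms by (rule borel_measurable_continuous_onI)
  ultimately show "integrable (lebesgue_on K) f"
    by (subst integrable_restrict_space) (auto simp: integrable_completion)
qed

lemma continuous_compact_support_L2:
  fixes f :: "'a::euclidean_space \<Rightarrow> 'b::euclidean_space"
  assumes "open \<Omega>" "continuous_on UNIV f" "compact K" "K \<subseteq> \<Omega>" "\<And>x. x \<notin> K \<Longrightarrow> f x = 0"
  shows "f \<in> L2 \<Omega>"
proof -
  have "integrable (lebesgue_on \<Omega>) (\<lambda>x. (norm (f x))\<^sup>2)"
    using assms by (intro integrable_compact_support(2)[OF _ assms(3)] continuous_intros) auto
  moreover have "f \<in> borel_measurable (lebesgue_on \<Omega>)"
    using integrable_compact_support(2)[OF assms(2,3,5,1,4)] by (rule borel_measurable_integrable)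
  ultimately show ?thesis by (simp add: L2_def)
qed

lemma test_function_L2:
  assumes "open \<Omega>" "test_function \<Omega> \<theta>"
  shows "\<theta> \<in> L2 \<Omega>" and "grad \<theta> \<in> L2 \<Omega>"
proof -
  obtain K where K: "compact K" "K \<subseteq> \<Omega>" "\<And>x. x \<notin> K \<Longrightarrow> \<theta> x = 0" "\<And>x. x \<notin> K \<Longrightarrow> grad \<theta> x = 0"
    using test_functionD[OF assms(2)] by blast
  note smooth = test_function_smooth[OF assms(2)]
  show "\<theta> \<in> L2 \<Omega>" "grad \<theta> \<in> L2 \<Omega>"
    using continuous_compact_support_L2[OF assms(1) _ K(1,2)] K(3,4)
      smooth_continuous_on[OF smooth] continuous_on_grad[OF smooth] by blast+
qed

lemma test_function_has_H10_gradient: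
  assumes "open \<Omega>" "test_function \<Omega> \<theta>"
  shows "has_H10_gradient \<Omega> \<theta> (grad \<theta>)"
proof -
  note smooth = test_function_smooth[OF assms(2)]
  have "(LINT x|lebesgue_on \<Omega>. \<theta> x *\<^sub>R grad \<phi> x) = - (LINT x|lebesgue_on \<Omega>. \<phi> x *\<^sub>R grad \<theta> x)"
    if \<phi>: "test_function \<Omega> \<phi>" for \<phi>
  proof (rule euclidean_eqI)
    fix b :: 'a
    obtain K where K: "compact K" "K \<subseteq> \<Omega>" "\<And>x. x \<notin> K \<Longrightarrow> \<theta> x = 0" "\<And>x. x \<notin> K \<Longrightarrow> grad \<theta> x = 0"
      using test_functionD[OF assms(2)] by blast
    have int: "integrable (lebesgue_on \<Omega>) (\<lambda>x. \<theta> x *\<^sub>R grad \<phi> x)"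
      "integrable (lebesgue_on \<Omega>) (\<lambda>x. \<phi> x *\<^sub>R grad \<theta> x)"
      using K assms(1) smooth_continuous_on[OF smooth] continuous_on_grad[OF smooth]
        smooth_continuous_on[OF test_function_smooth[OF \<phi>]]
        continuous_on_grad[OF test_function_smooth[OF \<phi>]]
      by (intro integrable_compact_support(2)[OF _ K(1)] continuous_on_scaleR; simp)+
    have "(LINT x|lebesgue_on \<Omega>. \<theta> x *\<^sub>R grad \<phi> x) \<bullet> b = (LINT x|lebesgue_on \<Omega>. \<theta> x * (grad \<phi> x \<bullet> b))"
      using integral_inner_left[OF int(1)] by simp
    also have "\<dots> = - (LINT x|lebesgue_on \<Omega>. (grad \<theta> x \<bullet> b) * \<phi> x)"
      by (rule integration_by_parts[OF assms(1) \<phi> smooth])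
    also have "\<dots> = - ((LINT x|lebesgue_on \<Omega>. \<phi> x *\<^sub>R grad \<theta> x) \<bullet> b)"
      using integral_inner_left[OF int(2)] by (simp add: mult.commute)
    finally show "(LINT x|lebesgue_on \<Omega>. \<theta> x *\<^sub>R grad \<phi> x) \<bullet> b =
        - (LINT x|lebesgue_on \<Omega>. \<phi> x *\<^sub>R grad \<theta> x) \<bullet> b"
      by simp
  qed
  then have "has_weak_gradient \<Omega> \<theta> (grad \<theta>)"
    using smooth by (simp add: has_weak_gradient_def locally_integrable_continuous
        smooth_continuous_on continuous_on_grad)
  then show ?thesis
    using assms test_function_L2[OF assms] unfolding has_H10_gradient_def has_H1_gradient_def
    by (auto intro!: exI[of _ "\<lambda>k. \<theta>"] simp: H1_norm_def)
qed

lemma L2_inner_integrable: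
  assumes "a \<in> L2 \<Omega>" "b \<in> L2 \<Omega>"
  shows "integrable (lebesgue_on \<Omega>) (\<lambda>x. a x \<bullet> b x)"
proof (rule Bochner_Integration.integrable_bound)
  show "integrable (lebesgue_on \<Omega>) (\<lambda>x. (norm (a x))\<^sup>2 + (norm (b x))\<^sup>2)"
    using assms by (auto simp: L2_def)
  show "(\<lambda>x. a x \<bullet> b x) \<in> borel_measurable (lebesgue_on \<Omega>)"
    using assms by (auto simp: L2_def)
  have "\<bar>v \<bullet> w\<bar> \<le> (norm v)\<^sup>2 + (norm w)\<^sup>2" for v w :: 'b
  proof -
    have "\<bar>v \<bullet> w\<bar> \<le> norm v * norm w" by (rule Cauchy_Schwarz_ineq2)
    also have "\<dots> \<le> (norm v)\<^sup>2 + (norm w)\<^sup>2"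
      using sum_squares_bound[of "norm v" "norm w"] mult_nonneg_nonneg[OF norm_ge_zero[of v] norm_ge_zero[of w]]
      by linarith
    finally show ?thesis .
  qed
  then show "AE x in lebesgue_on \<Omega>. norm (a x \<bullet> b x) \<le> norm ((norm (a x))\<^sup>2 + (norm (b x))\<^sup>2)"
    by simp
qed

lemma L2_diff:
  assumes "a \<in> L2 \<Omega>" "b \<in> L2 \<Omega>"
  shows "(\<lambda>x. a x - b x) \<in> L2 \<Omega>"
proof -
  have "integrable (lebesgue_on \<Omega>) (\<lambda>x. a x \<bullet> a x - 2 * (a x \<bullet> b x) + b x \<bullet> b x)"
    using assms by (intro Bochner_Integration.integrable_add Bochner_Integration.integrable_diff
        integrable_mult_right L2_inner_integrable)
  also have "(\<lambda>x. a x \<bullet> a x - 2 * (a x \<bullet> b x) + b x \<bullet> b x) = (\<lambda>x. (norm (a x - b x))\<^sup>2)"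
    by (simp add: power2_norm_eq_inner inner_diff inner_commute fun_eq_iff)
  finally show ?thesis
    using assms by (auto simp: L2_def)
qed

section \<open>Weak comparison\<close>

text \<open>Smooth substitute for the positive part of \<open>\<phi> + \<psi> - \<sigma>\<close>. The bound \<open>\<psi> \<le> \<sigma>\<close> on the whole space
  keeps its support inside the support of \<open>\<phi>\<close>.\<close>

lemma test_function_truncation:
  assumes "test_function \<Omega> \<phi>" "smooth \<psi>" "\<And>x. \<psi> x \<le> \<sigma>"
  shows "test_function \<Omega> (\<lambda>x. flat (\<phi> x + \<psi> x - \<sigma>))"
    and "grad (\<lambda>x. flat (\<phi> x + \<psi> x - \<sigma>)) x =
      flat_slope (\<phi> x + \<psi> x - \<sigma>) *\<^sub>R (grad \<phi> x + grad \<psi> x)"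
proof -
  let ?\<theta> = "\<lambda>x. flat (\<phi> x + \<psi> x - \<sigma>)"
  note \<phi> = test_function_smooth[OF assms(1)]
  have "smooth (\<lambda>x. \<phi> x + \<psi> x + (- \<sigma>))"
    by (intro smooth_add smooth_const \<phi> assms(2))
  then have smooth: "smooth ?\<theta>"
    by (intro smooth_flat_exp) simp
  have "{x. ?\<theta> x \<noteq> 0} \<subseteq> {x. \<phi> x \<noteq> 0}"
    using assms(3) by (auto simp: flat_bounds(4))
  then have sub: "closure {x. ?\<theta> x \<noteq> 0} \<subseteq> closure {x. \<phi> x \<noteq> 0}"
    by (rule closure_mono)
  then have "compact (closure {x. ?\<theta> x \<noteq> 0})"
    using assms(1) compact_Int_closed[of "closure {x. \<phi> x \<noteq> 0}" "closure {x. ?\<theta> x \<noteq> 0}"]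
    by (simp add: test_function_def Int_absorb1)
  then show "test_function \<Omega> ?\<theta>"
    using smooth sub assms(1) by (auto simp: test_function_def)
  show "grad ?\<theta> x = flat_slope (\<phi> x + \<psi> x - \<sigma>) *\<^sub>R (grad \<phi> x + grad \<psi> x)"
  proof (rule grad_eqI)
    have "((\<lambda>x. \<phi> x + \<psi> x - \<sigma>) has_derivative (\<lambda>v. grad \<phi> x \<bullet> v + grad \<psi> x \<bullet> v - 0)) (at x)"
      by (intro has_derivative_add has_derivative_diff has_derivative_const
          smooth_has_derivative_grad \<phi> assms(2))
    from DERIV_compose_FDERIV[OF flat_has_derivative this]
    show "(?\<theta> has_derivative
        (\<lambda>v. (flat_slope (\<phi> x + \<psi> x - \<sigma>) *\<^sub>R (grad \<phi> x + grad \<psi> x)) \<bullet> v)) (at x)"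
      by (simp add: inner_add_left mult.commute)
  qed
qed

lemma H1_norm_sq:
  "(H1_norm \<Omega> u g)\<^sup>2 = (LINT x|lebesgue_on \<Omega>. (u x)\<^sup>2) + (LINT x|lebesgue_on \<Omega>. (norm (g x))\<^sup>2)"
  unfolding H1_norm_def by (intro real_sqrt_pow2 add_nonneg_nonneg Bochner_Integration.integral_nonneg) auto

text \<open>Applied with \<open>a = g + grad \<psi>\<close>, \<open>d\<close> the error in the gradient of \<open>u\<close> and \<open>m = flat_slope\<close>, so that
  \<open>m *\<^sub>R (a + d)\<close> is the gradient of the truncation. The bound does not involve \<open>a\<close> and hence tends to
  zero with \<open>d\<close>.\<close>

lemma inner_square_completion:
  fixes a d :: "'a::real_inner"
  assumes "0 \<le> m" "m \<le> 2"
  shows "- (a \<bullet> (m *\<^sub>R (a + d))) \<le> (norm d)\<^sup>2 / 2"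
proof -
  have "0 \<le> (norm (2 *\<^sub>R a + d))\<^sup>2" by simp
  also have "\<dots> = 4 * (a \<bullet> (a + d)) + (norm d)\<^sup>2"
    by (simp add: power2_norm_eq_inner inner_add inner_commute algebra_simps)
  finally have "- (a \<bullet> (a + d)) \<le> (norm d)\<^sup>2 / 4" by simp
  then have "m * - (a \<bullet> (a + d)) \<le> m * ((norm d)\<^sup>2 / 4)"
    using assms(1) by (rule mult_left_mono)
  also have "\<dots> \<le> 2 * ((norm d)\<^sup>2 / 4)"
    using assms(2) by (rule mult_right_mono) simp
  finally show ?thesis by simp
qed

text \<open>Comparison of the supersolution \<open>\<sigma> - u\<close> with the subsolution \<open>\<psi>\<close> of \<open>- \<Delta> w + C * w = 0\<close>; the
  boundary inequality is expressed by \<open>u\<close> lying in \<open>H\<^sub>0\<^sup>1(\<Omega>)\<close> and \<open>\<psi> \<le> \<sigma>\<close>. Adding the two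
  inequalities for the truncations \<open>\<theta>\<close> of \<open>\<phi>\<^sub>k\<close> bounds \<open>C\<close> times the integral of \<open>s * \<theta>\<close> by that of
  \<open>- (g + grad \<psi>) \<bullet> grad \<theta>\<close>, which is nonpositive up to the approximation error.\<close>

lemma weak_comparison:
  fixes \<Omega> :: "'a::euclidean_space set" and \<sigma> C :: real
  assumes \<Omega>: "open \<Omega>" "bounded \<Omega>"
    and u: "has_H10_gradient \<Omega> u g" "AE x in lebesgue_on \<Omega>. \<bar>u x\<bar> \<le> \<sigma>"
    and \<psi>: "smooth \<psi>" "\<And>x. 0 \<le> \<psi> x" "\<And>x. \<psi> x \<le> \<sigma>"
    and "C > 0"
    and super: "\<And>\<theta>. \<lbrakk>test_function \<Omega> \<theta>; \<And>x. 0 \<le> \<theta> x\<rbrakk> \<Longrightarrow>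
      (LINT x|lebesgue_on \<Omega>. g x \<bullet> grad \<theta> x) \<le> (LINT x|lebesgue_on \<Omega>. C * (\<sigma> - u x) * \<theta> x)"
    and sub: "\<And>\<theta>. \<lbrakk>test_function \<Omega> \<theta>; \<And>x. 0 \<le> \<theta> x\<rbrakk> \<Longrightarrow>
      (LINT x|lebesgue_on \<Omega>. grad \<psi> x \<bullet> grad \<theta> x) \<le> - (LINT x|lebesgue_on \<Omega>. C * \<psi> x * \<theta> x)"
  shows "AE x in lebesgue_on \<Omega>. u x + \<psi> x \<le> \<sigma>"
proof -
  let ?M = "lebesgue_on \<Omega>"
  define s where "s x = u x + \<psi> x - \<sigma>" for x
  define I where "I = (LINT x|?M. s x * flat (s x / 2))"
  have "\<Omega> \<in> lmeasurable"
    using \<Omega> by (simp add: bounded_set_imp_lmeasurable)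
  then interpret finite_measure ?M
    by (rule finite_measure_lebesgue_on)
  have uL2: "u \<in> L2 \<Omega>" and gL2: "g \<in> L2 \<Omega>"
    using u(1) by (simp_all add: has_H10_gradient_def has_H1_gradient_def)
  obtain \<phi> where \<phi>: "\<And>k. test_function \<Omega> (\<phi> k)"
    and lim: "(\<lambda>k. H1_norm \<Omega> (\<lambda>x. u x - \<phi> k x) (\<lambda>x. g x - grad (\<phi> k) x)) \<longlonglongrightarrow> 0"
    using u(1) unfolding has_H10_gradient_def by blast
  have [measurable]: "u \<in> borel_measurable ?M" "\<psi> \<in> borel_measurable ?M"
    using uL2 continuous_imp_measurable_on_sets_lebesgue[OF smooth_continuous_on[OF \<psi>(1)]] \<Omega>(1)
    by (auto simp: L2_def)
  have [measurable]: "flat \<in> borel_measurable borel"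
    by (intro borel_measurable_continuous_onI continuous_at_imp_continuous_on ballI
        DERIV_isCont[OF flat_exp_has_derivative])
  have s_meas: "(\<lambda>x. s x * flat (s x / 2)) \<in> borel_measurable ?M"
    unfolding s_def by measurable
  have s_nonneg: "0 \<le> s x * flat (s x / 2)" for x
    using flat_bounds(1,4)[of "s x / 2"] by (cases "s x \<ge> 0") auto
  have s_int: "integrable ?M (\<lambda>x. s x * flat (s x / 2))"
  proof (rule integrable_const_bound[OF _ s_meas])
    have "\<bar>s x * flat (s x / 2)\<bar> \<le> 2 * \<sigma>" if "\<bar>u x\<bar> \<le> \<sigma>" for x
    proof -
      have "\<bar>s x\<bar> \<le> 2 * \<sigma>" using that \<psi>(2,3)[of x] by (simp add: s_def abs_le_iff)
      moreover have "\<bar>flat (s x / 2)\<bar> \<le> 1" using flat_bounds(1,3)[of "s x / 2"] by simp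
      ultimately have "\<bar>s x\<bar> * \<bar>flat (s x / 2)\<bar> \<le> 2 * \<sigma> * 1"
        by (intro mult_mono) auto
      then show ?thesis by (simp add: abs_mult)
    qed
    then show "AE x in ?M. norm (s x * flat (s x / 2)) \<le> 2 * \<sigma>"
      using u(2) by auto
  qed
  \<comment> \<open>4 comes from \<open>flat_perturb\<close>; the 1 absorbs the factor one half of \<open>inner_square_completion\<close>.\<close>
  have bound: "C * I \<le> (4 * C + 1) * (H1_norm \<Omega> (\<lambda>x. u x - \<phi> k x) (\<lambda>x. g x - grad (\<phi> k) x))\<^sup>2" for k
  proof -
    define \<theta> where "\<theta> = (\<lambda>x. flat (\<phi> k x + \<psi> x - \<sigma>))"
    have \<theta>: "test_function \<Omega> \<theta>"
      and grad_\<theta>: "grad \<theta> x = flat_slope (\<phi> k x + \<psi> x - \<sigma>) *\<^sub>R (grad (\<phi> k) x + grad \<psi> x)" for x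
      unfolding \<theta>_def using test_function_truncation[OF \<phi> \<psi>(1,3)] by auto
    have \<theta>_nonneg: "0 \<le> \<theta> x" for x
      by (simp add: \<theta>_def flat_bounds)
    let ?e = "\<lambda>x. u x - \<phi> k x" and ?d = "\<lambda>x. g x - grad (\<phi> k) x"
    have e_int: "integrable ?M (\<lambda>x. (?e x)\<^sup>2)" and d_int: "integrable ?M (\<lambda>x. (norm (?d x))\<^sup>2)"
      using L2_diff[OF uL2 test_function_L2(1)[OF \<Omega>(1) \<phi>]]
        L2_diff[OF gL2 test_function_L2(2)[OF \<Omega>(1) \<phi>]]
      by (simp_all add: L2_def)
    have g_int: "integrable ?M (\<lambda>x. g x \<bullet> grad \<theta> x)"
      by (intro L2_inner_integrable gL2 test_function_L2(2) \<Omega>(1) \<theta>)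
    have grad_int: "integrable ?M (\<lambda>x. grad \<psi> x \<bullet> grad \<theta> x)"
      by (intro integrable_grad_test_function \<Omega>(1) \<theta> continuous_on_grad \<psi>(1))
    have \<psi>_int: "integrable ?M (\<lambda>x. \<psi> x * \<theta> x)"
      by (intro integrable_test_function \<Omega>(1) \<theta> smooth_continuous_on \<psi>(1))
    have \<theta>_int: "integrable ?M (\<lambda>x. \<theta> x)"
      using integrable_test_function[OF \<Omega>(1) \<theta>, of "\<lambda>x. 1"] by simp
    have u\<theta>_int: "integrable ?M (\<lambda>x. u x * \<theta> x)"
      using L2_inner_integrable[OF uL2 test_function_L2(1)[OF \<Omega>(1) \<theta>]] by simp
    have s\<theta>_int: "integrable ?M (\<lambda>x. s x * \<theta> x)"
      using \<psi>_int \<theta>_int u\<theta>_int by (simp add: s_def ring_distribs)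
    have "C * I = (LINT x|?M. C * (s x * flat (s x / 2)))"
      by (simp add: I_def)
    also have "\<dots> \<le> (LINT x|?M. C * (s x * \<theta> x) + 4 * C * (?e x)\<^sup>2)"
    proof (intro integral_mono)
      fix x
      have "s x * flat (s x / 2) \<le> s x * \<theta> x + 4 * (?e x)\<^sup>2"
      proof -
        have shift: "s x + - ?e x = \<phi> k x + \<psi> x - \<sigma>" by (simp add: s_def)
        show ?thesis
          using flat_perturb[of "s x" "- ?e x"] unfolding shift by (simp add: \<theta>_def power2_commute)
      qed
      then have "C * (s x * flat (s x / 2)) \<le> C * (s x * \<theta> x + 4 * (?e x)\<^sup>2)"
        using \<open>C > 0\<close> by (intro mult_left_mono) auto
      then show "C * (s x * flat (s x / 2)) \<le> C * (s x * \<theta> x) + 4 * C * (?e x)\<^sup>2"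
        by (simp add: distrib_left)
    qed (use s_int s\<theta>_int e_int in auto)
    also have "\<dots> = C * (LINT x|?M. s x * \<theta> x) + 4 * C * (LINT x|?M. (?e x)\<^sup>2)"
      using s\<theta>_int e_int by simp
    also have "C * (LINT x|?M. s x * \<theta> x) \<le> (LINT x|?M. (norm (?d x))\<^sup>2) / 2"
    proof -
      have "C * (LINT x|?M. s x * \<theta> x) =
          (LINT x|?M. C * \<psi> x * \<theta> x) - (LINT x|?M. C * (\<sigma> - u x) * \<theta> x)"
        using \<psi>_int \<theta>_int u\<theta>_int by (simp add: s_def ring_distribs mult.assoc)
      also have "\<dots> \<le> - (LINT x|?M. grad \<psi> x \<bullet> grad \<theta> x) - (LINT x|?M. g x \<bullet> grad \<theta> x)"
        using super[OF \<theta> \<theta>_nonneg] sub[OF \<theta> \<theta>_nonneg] by linarith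
      also have "\<dots> = (LINT x|?M. - ((g x + grad \<psi> x) \<bullet> grad \<theta> x))"
        using g_int grad_int by (simp add: inner_add_left)
      also have "\<dots> \<le> (LINT x|?M. (norm (?d x))\<^sup>2 / 2)"
      proof (intro integral_mono)
        fix x
        have "grad \<theta> x = flat_slope (\<phi> k x + \<psi> x - \<sigma>) *\<^sub>R ((g x + grad \<psi> x) + (- ?d x))"
          by (simp add: grad_\<theta>)
        then show "- ((g x + grad \<psi> x) \<bullet> grad \<theta> x) \<le> (norm (?d x))\<^sup>2 / 2"
          using inner_square_completion[OF flat_slope_bounds, where a = "g x + grad \<psi> x" and d = "- ?d x"]
          by (metis norm_minus_cancel)
      qed (use g_int grad_int d_int in \<open>auto simp: inner_add_left\<close>)
      finally show ?thesis by simp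
    qed
    finally have "C * I \<le> (LINT x|?M. (norm (?d x))\<^sup>2) / 2 + 4 * C * (LINT x|?M. (?e x)\<^sup>2)"
      by simp
    moreover have "0 \<le> (LINT x|?M. (norm (?d x))\<^sup>2)" "0 \<le> (LINT x|?M. (?e x)\<^sup>2)"
      by (auto intro!: Bochner_Integration.integral_nonneg)
    moreover from this have "0 \<le> C * (LINT x|?M. (norm (?d x))\<^sup>2)"
      using \<open>C > 0\<close> by simp
    ultimately show ?thesis
      unfolding H1_norm_sq ring_distribs by linarith
  qed
  have "(\<lambda>k. (4 * C + 1) * (H1_norm \<Omega> (\<lambda>x. u x - \<phi> k x) (\<lambda>x. g x - grad (\<phi> k) x))\<^sup>2)
      \<longlonglongrightarrow> (4 * C + 1) * 0\<^sup>2"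
    by (intro tendsto_intros lim)
  then have "C * I \<le> (4 * C + 1) * 0\<^sup>2"
    using bound by (intro LIMSEQ_le_const) auto
  then have "I \<le> 0"
    using \<open>C > 0\<close> by (simp add: mult_le_0_iff)
  moreover have "0 \<le> I"
    unfolding I_def using s_nonneg by (intro Bochner_Integration.integral_nonneg)
  ultimately have "I = 0" by simp
  then have "AE x in ?M. s x * flat (s x / 2) = 0"
    unfolding I_def using integral_nonneg_eq_0_iff_AE[OF s_int] s_nonneg by blast
  moreover have "u x + \<psi> x \<le> \<sigma>" if "s x * flat (s x / 2) = 0" for x
    using that flat_bounds(5)[of "s x / 2"] by (cases "s x > 0") (auto simp: s_def)
  ultimately show ?thesis by auto
qed

text \<open>A Gaussian \<open>\<sigma> * exp (- \<tau>\<^sup>2)\<close> in the single coordinate \<open>\<tau> = x \<bullet> e - T\<close>. Its Laplacian is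
  \<open>(4 * \<tau>\<^sup>2 - 2)\<close> times itself, which is at least \<open>C\<close> times itself on \<open>\<Omega>\<close> once its centre \<open>T\<close> is far enough
  away. A Gaussian, rather than an exponential, stays below \<open>\<sigma>\<close> on the whole space, as the
  truncation demands.\<close>

lemma positive_subsolution:
  fixes \<Omega> :: "'a::euclidean_space set" and \<sigma> C :: real
  assumes \<Omega>: "open \<Omega>" "bounded \<Omega>" and "\<sigma> > 0" "C > 0"
  obtains \<psi> \<delta> where "smooth \<psi>" "\<And>x. 0 \<le> \<psi> x" "\<And>x. \<psi> x \<le> \<sigma>"
    and "\<delta> > 0" "\<And>x. x \<in> \<Omega> \<Longrightarrow> \<delta> \<le> \<psi> x"
    and "\<And>\<theta>. \<lbrakk>test_function \<Omega> \<theta>; \<And>x. 0 \<le> \<theta> x\<rbrakk> \<Longrightarrow>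
      (LINT x|lebesgue_on \<Omega>. grad \<psi> x \<bullet> grad \<theta> x) \<le> - (LINT x|lebesgue_on \<Omega>. C * \<psi> x * \<theta> x)"
proof -
  obtain e :: 'a where "e \<in> Basis"
    using nonempty_Basis by blast
  then have e: "norm e = 1" by simp
  obtain R where "R > 0" and R: "\<And>x. x \<in> \<Omega> \<Longrightarrow> norm x \<le> R"
    using \<Omega>(2) unfolding bounded_pos by blast
  \<comment> \<open>On \<open>\<Omega>\<close> this shift gives \<open>\<bar>\<tau>\<bar> \<ge> C + 1\<close>, hence \<open>4 * \<tau>\<^sup>2 - 2 \<ge> C\<close>.\<close>
  define \<tau> where "\<tau> x = x \<bullet> e + - (R + C + 1)" for x
  define \<psi> where "\<psi> x = \<sigma> * exp (- 1 * (\<tau> x * \<tau> x))" for x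
  define q where "q x = - 2 * (\<tau> x * \<psi> x)" for x
  have \<tau>: "smooth \<tau>"
    unfolding \<tau>_def[abs_def] by (intro smooth_add smooth_inner smooth_const)
  have \<psi>: "smooth \<psi>"
    unfolding \<psi>_def[abs_def] by (intro smooth_mult smooth_exp smooth_const \<tau>)
  have q: "smooth q"
    unfolding q_def[abs_def] by (intro smooth_mult smooth_const \<tau> \<psi>)
  have \<tau>_deriv: "(\<tau> has_derivative (\<lambda>v. v \<bullet> e)) (at x)" for x
    unfolding \<tau>_def[abs_def] by (auto intro!: derivative_eq_intros)
  have \<psi>_deriv: "(\<psi> has_derivative (\<lambda>v. (q x *\<^sub>R e) \<bullet> v)) (at x)" for x
    unfolding \<psi>_def[abs_def]
    by (rule derivative_eq_intros \<tau>_deriv refl)+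
       (simp add: q_def \<psi>_def fun_eq_iff inner_commute algebra_simps)
  have grad_\<psi>: "grad \<psi> x = q x *\<^sub>R e" for x
    by (rule grad_eqI[OF \<psi>_deriv])
  have grad_q: "grad q x = ((4 * (\<tau> x)\<^sup>2 - 2) * \<psi> x) *\<^sub>R e" for x
  proof (rule grad_eqI)
    show "(q has_derivative (\<lambda>v. (((4 * (\<tau> x)\<^sup>2 - 2) * \<psi> x) *\<^sub>R e) \<bullet> v)) (at x)"
      unfolding q_def[abs_def]
      by (rule derivative_eq_intros \<tau>_deriv \<psi>_deriv refl)+
         (simp add: q_def fun_eq_iff inner_commute algebra_simps power2_eq_square)
  qed
  have \<tau>_bounds: "C + 1 \<le> - \<tau> x" "- \<tau> x \<le> 2 * R + C + 1" if "x \<in> \<Omega>" for x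
  proof -
    have "\<bar>x \<bullet> e\<bar> \<le> norm x * norm e" by (rule Cauchy_Schwarz_ineq2)
    then have "\<bar>x \<bullet> e\<bar> \<le> R" using R[OF that] e by simp
    then show "C + 1 \<le> - \<tau> x" "- \<tau> x \<le> 2 * R + C + 1" by (simp_all add: \<tau>_def abs_le_iff)
  qed
  show ?thesis
  proof
    show "smooth \<psi>" by (rule \<psi>)
    show "0 \<le> \<psi> x" "\<psi> x \<le> \<sigma>" for x
      using \<open>\<sigma> > 0\<close> by (simp_all add: \<psi>_def mult_left_le)
    show "0 < \<sigma> * exp (- ((2 * R + C + 1) * (2 * R + C + 1)))"
      using \<open>\<sigma> > 0\<close> by simp
    show "\<sigma> * exp (- ((2 * R + C + 1) * (2 * R + C + 1))) \<le> \<psi> x" if "x \<in> \<Omega>" for x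
    proof -
      have "- \<tau> x * - \<tau> x \<le> (2 * R + C + 1) * (2 * R + C + 1)"
        using \<tau>_bounds[OF that] \<open>C > 0\<close> \<open>R > 0\<close> by (intro mult_mono) auto
      then show ?thesis using \<open>\<sigma> > 0\<close> by (simp add: \<psi>_def)
    qed
    fix \<theta> assume \<theta>: "test_function \<Omega> \<theta>" "\<And>x. 0 \<le> \<theta> x"
    have "(LINT x|lebesgue_on \<Omega>. grad \<psi> x \<bullet> grad \<theta> x) = (LINT x|lebesgue_on \<Omega>. q x * (grad \<theta> x \<bullet> e))"
      by (simp add: grad_\<psi> inner_commute)
    also have "\<dots> = - (LINT x|lebesgue_on \<Omega>. (grad q x \<bullet> e) * \<theta> x)"
      by (rule integration_by_parts[OF \<Omega>(1) \<theta>(1) q])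
    also have "\<dots> \<le> - (LINT x|lebesgue_on \<Omega>. C * \<psi> x * \<theta> x)"
    proof (intro le_imp_neg_le integral_mono)
      show "integrable (lebesgue_on \<Omega>) (\<lambda>x. C * \<psi> x * \<theta> x)"
        by (intro integrable_test_function[OF \<Omega>(1) \<theta>(1)] smooth_continuous_on smooth_mult smooth_const \<psi>)
      show "integrable (lebesgue_on \<Omega>) (\<lambda>x. (grad q x \<bullet> e) * \<theta> x)"
        by (intro integrable_test_function[OF \<Omega>(1) \<theta>(1)] smooth_continuous_on smooth_grad_inner q)
      fix x assume "x \<in> space (lebesgue_on \<Omega>)"
      then have "C + 1 \<le> - \<tau> x" using \<tau>_bounds by simp
      then have "(C + 1) * (C + 1) \<le> - \<tau> x * - \<tau> x"
        using \<open>C > 0\<close> by (intro mult_mono) auto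
      moreover have "0 \<le> C * C" by simp
      ultimately have "C \<le> 4 * (- \<tau> x * - \<tau> x) - 2"
        using \<open>C > 0\<close> by (simp only: ring_distribs)
      then have "C \<le> 4 * (\<tau> x)\<^sup>2 - 2"
        by (simp add: power2_eq_square)
      then have "C * (\<psi> x * \<theta> x) \<le> (4 * (\<tau> x)\<^sup>2 - 2) * (\<psi> x * \<theta> x)"
        using \<open>\<sigma> > 0\<close> \<theta>(2) by (intro mult_right_mono) (auto simp: \<psi>_def)
      moreover have "grad q x \<bullet> e = (4 * (\<tau> x)\<^sup>2 - 2) * \<psi> x"
        using e by (simp add: grad_q power2_norm_eq_inner[symmetric])
      ultimately show "C * \<psi> x * \<theta> x \<le> grad q x \<bullet> e * \<theta> x"
        by (simp add: mult.assoc)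
    qed
    finally show "(LINT x|lebesgue_on \<Omega>. grad \<psi> x \<bullet> grad \<theta> x) \<le> - (LINT x|lebesgue_on \<Omega>. C * \<psi> x * \<theta> x)" .
  qed
qed

section \<open>The nonlinearity and the conclusion\<close>

lemma one_sided_linear_bound:
  fixes f :: "real \<Rightarrow> real"
  assumes cont: "continuous_on UNIV f" and "f \<sigma> \<le> 0" "M > 0" "\<epsilon> > 0"
    and mono: "mono_on {\<sigma> - \<epsilon><..<\<sigma>} (\<lambda>s. f s + M * s)"
  obtains C where "C > 0" "\<And>s. \<lbrakk>0 \<le> s; s \<le> \<sigma>\<rbrakk> \<Longrightarrow> f s \<le> C * (\<sigma> - s)"
proof -
  have near: "f s \<le> M * (\<sigma> - s)" if "\<sigma> - \<epsilon> < s" "s \<le> \<sigma>" for s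
  proof (cases "s = \<sigma>")
    case False
    then have "s < \<sigma>" using that by simp
    have "((\<lambda>t. f t + M * t) \<longlongrightarrow> f \<sigma> + M * \<sigma>) (at_left \<sigma>)"
      using cont by (intro tendsto_intros) (auto simp: continuous_on_def intro: tendsto_within_subset)
    moreover have "\<forall>\<^sub>F t in at_left \<sigma>. f s + M * s \<le> f t + M * t"
      unfolding eventually_at_left_field
      using \<open>s < \<sigma>\<close> that monotone_onD[OF mono, of s] by (intro exI[of _ s]) auto
    ultimately have "f s + M * s \<le> f \<sigma> + M * \<sigma>"
      by (intro tendsto_lowerbound) auto
    then show ?thesis using \<open>f \<sigma> \<le> 0\<close> by (simp add: algebra_simps)
  qed (use \<open>f \<sigma> \<le> 0\<close> in simp)
  have "bounded (f ` {0..\<sigma>})"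
    using continuous_on_subset[OF cont]
    by (intro compact_imp_bounded compact_continuous_image) auto
  then obtain B where "B > 0" and B: "\<And>s. s \<in> {0..\<sigma>} \<Longrightarrow> \<bar>f s\<bar> \<le> B"
    unfolding bounded_pos by auto
  show ?thesis
  proof
    show "0 < max M (B / \<epsilon>)" using \<open>M > 0\<close> by simp
    fix s assume s: "0 \<le> s" "s \<le> \<sigma>"
    show "f s \<le> max M (B / \<epsilon>) * (\<sigma> - s)"
    proof (cases "\<sigma> - \<epsilon> < s")
      case True
      then have "f s \<le> M * (\<sigma> - s)" using near s by simp
      also have "\<dots> \<le> max M (B / \<epsilon>) * (\<sigma> - s)"
        using s by (intro mult_right_mono) auto
      finally show ?thesis .
    next
      case False
      have "f s \<le> B / \<epsilon> * \<epsilon>" using B[of s] s \<open>\<epsilon> > 0\<close> by simp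
      also have "\<dots> \<le> max M (B / \<epsilon>) * (\<sigma> - s)"
        using False s \<open>M > 0\<close> \<open>\<epsilon> > 0\<close> by (intro mult_mono) auto
      finally show ?thesis .
    qed
  qed
qed

theorem lemma2p3:
  fixes \<Omega> :: "(real ^ 'n) set" and f :: "real \<Rightarrow> real" and \<sigma> M \<epsilon> :: real
  assumes "smooth_open \<Omega>" and "bounded \<Omega>"
    and "continuous_on UNIV f" and "f 0 \<ge> 0"
    and "\<forall>s\<le>0. f s = f 0"
    and "\<sigma> > 0" and "f \<sigma> \<le> 0"
    and "M > 0" and "\<epsilon> > 0"
    and "mono_on {\<sigma> - \<epsilon><..<\<sigma>} (\<lambda>s. f s + M * s)"
  shows "\<forall>l\<ge>0. \<not> (\<exists>u \<in> H10 \<Omega> \<inter> Linf \<Omega>.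
           positive_on \<Omega> u \<and> weak_solution \<Omega> (\<lambda>s. l * f s) u \<and> Linf_norm \<Omega> u = ereal \<sigma>)"
proof (intro allI impI notI)
  fix l :: real
  assume "l \<ge> 0" and "\<exists>u \<in> H10 \<Omega> \<inter> Linf \<Omega>.
    positive_on \<Omega> u \<and> weak_solution \<Omega> (\<lambda>s. l * f s) u \<and> Linf_norm \<Omega> u = ereal \<sigma>"
  then obtain u where u: "u \<in> Linf \<Omega>" "positive_on \<Omega> u" "weak_solution \<Omega> (\<lambda>s. l * f s) u"
    and norm_u: "Linf_norm \<Omega> u = ereal \<sigma>"
    by blast
  have \<Omega>: "open \<Omega>" using assms(1) by (simp add: smooth_open_def)
  let ?M = "lebesgue_on \<Omega>"
  have u_meas: "u \<in> borel_measurable ?M" using u(1) by (simp add: Linf_def)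
  have u_le: "AE x in ?M. \<bar>u x\<bar> \<le> \<sigma>"
    using esssup_AE[of "\<lambda>x. ereal \<bar>u x\<bar>" ?M] norm_u by (simp add: Linf_norm_def)
  have u_pos: "AE x in ?M. 0 < u x" using u(2) by (simp add: positive_on_def)
  obtain C0 where "C0 > 0" and C0: "\<And>s. \<lbrakk>0 \<le> s; s \<le> \<sigma>\<rbrakk> \<Longrightarrow> f s \<le> C0 * (\<sigma> - s)"
    using one_sided_linear_bound[OF assms(3,7,8,9,10)] by blast
  \<comment> \<open>The summand 1 keeps \<open>C\<close> positive when \<open>l = 0\<close>.\<close>
  define C where "C = l * C0 + 1"
  have "C > 0" using \<open>l \<ge> 0\<close> \<open>C0 > 0\<close> by (simp add: C_def add_nonneg_pos)
  have C: "l * f s \<le> C * (\<sigma> - s)" if "0 \<le> s" "s \<le> \<sigma>" for s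
  proof -
    have "l * f s \<le> l * (C0 * (\<sigma> - s))"
      using C0[OF that] \<open>l \<ge> 0\<close> by (rule mult_left_mono)
    then show ?thesis using that by (simp add: C_def distrib_right mult.assoc)
  qed
  obtain g where g: "has_H10_gradient \<Omega> u g"
    and weak: "\<And>v h. has_H10_gradient \<Omega> v h \<Longrightarrow> integrable ?M (\<lambda>x. l * f (u x) * v x) \<and>
      (LINT x|?M. g x \<bullet> h x) = (LINT x|?M. l * f (u x) * v x)"
    using u(3) unfolding weak_solution_def by blast
  have super: "(LINT x|?M. g x \<bullet> grad \<theta> x) \<le> (LINT x|?M. C * (\<sigma> - u x) * \<theta> x)"
    if \<theta>: "test_function \<Omega> \<theta>" "\<And>x. 0 \<le> \<theta> x" for \<theta>
  proof -
    note weak_\<theta> = weak[OF test_function_has_H10_gradient[OF \<Omega> \<theta>(1)]]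
    have "u \<in> L2 \<Omega>"
      using g by (simp add: has_H10_gradient_def has_H1_gradient_def)
    then have "integrable ?M (\<lambda>x. u x * \<theta> x)" "integrable ?M (\<lambda>x. \<theta> x)"
      using L2_inner_integrable[of u \<Omega>, OF _ test_function_L2(1)[OF \<Omega> \<theta>(1)]]
        integrable_test_function[OF \<Omega> \<theta>(1), of "\<lambda>x. 1"] by simp_all
    then have "integrable ?M (\<lambda>x. C * (\<sigma> - u x) * \<theta> x)"
      by (simp add: ring_distribs mult.assoc)
    moreover have "AE x in ?M. l * f (u x) * \<theta> x \<le> C * (\<sigma> - u x) * \<theta> x"
      using u_le u_pos
    proof eventually_elim
      case (elim x)
      then show ?case using C[of "u x"] \<theta>(2)[of x] by (intro mult_right_mono) auto
    qed
    ultimately have "(LINT x|?M. l * f (u x) * \<theta> x) \<le> (LINT x|?M. C * (\<sigma> - u x) * \<theta> x)"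
      using weak_\<theta> by (intro integral_mono_AE) auto
    then show ?thesis using weak_\<theta> by simp
  qed
  obtain \<psi> \<delta> where \<psi>: "smooth \<psi>" "\<And>x. 0 \<le> \<psi> x" "\<And>x. \<psi> x \<le> \<sigma>"
    and \<delta>: "\<delta> > 0" "\<And>x. x \<in> \<Omega> \<Longrightarrow> \<delta> \<le> \<psi> x"
    and sub: "\<And>\<theta>. \<lbrakk>test_function \<Omega> \<theta>; \<And>x. 0 \<le> \<theta> x\<rbrakk> \<Longrightarrow>
      (LINT x|?M. grad \<psi> x \<bullet> grad \<theta> x) \<le> - (LINT x|?M. C * \<psi> x * \<theta> x)"
    using positive_subsolution[OF \<Omega> assms(2,6) \<open>C > 0\<close>] by blast
  have "AE x in ?M. u x + \<psi> x \<le> \<sigma>"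
    by (rule weak_comparison[OF \<Omega> assms(2) g u_le \<psi> \<open>C > 0\<close> super sub])
  then have "AE x in ?M. ereal \<bar>u x\<bar> \<le> ereal (\<sigma> - \<delta>)"
    using u_pos AE_space
  proof eventually_elim
    case (elim x)
    then show ?case using \<delta>(2)[of x] by simp
  qed
  then have "Linf_norm \<Omega> u \<le> ereal (\<sigma> - \<delta>)"
    unfolding Linf_norm_def using u_meas by (intro esssup_I) auto
  then show False using norm_u \<delta>(1) by simp
qed

end
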